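(* Let $\{\mathbf{X}_n\}_{n\ge1}$ be a stationary sequence satisfying the strong-mixing condition and $\{\mathbf{u}_n^{(\pmb{\tau})}=(u_{n1}^{(\tau_1)},\ldots,u_{nd}^{(\tau_d)})\}$ a sequence of normalized real levels for which $\Gamma(\pmb{\tau})$ exists. Then: (a) $$\begin{aligned}\theta(\pmb{\tau})\Gamma(\pmb{\tau})=\lim_{n\to\infty}k_nP(N_{r_n}>0)=&\sum_{j=1}^d\theta_j\tau_j-\sum_{j=1}^{d-1}\theta^{**}_{\{j,\ldots,d\}}\tau^{**}_{\{j,\ldots,d\}}\Big(\bigwedge_{i=j}^d\tau_i\Big)\\&-\sum_{j=1}^{d-1}\theta^{*}_{\{j,\ldots,d\}}(\pmb{\tau}_{\{j,\ldots,d\}})\,\Gamma^{*}_{\{j,\ldots,d\}}(\pmb{\tau}_{\{j,\ldots,d\}})\,\beta^{(1)}_j(\pmb{\tau}_{\{j,\ldots,d\}})\\&-\sum_{j=1}^{d-1}\ \sum_{\emptyset\neq J\subset\{j+1,\ldots,d\}}(-1)^{|J|+1}\beta^{(2)}_{\{j\}\cup J}(\pmb{\tau}_{\{j\}\cup J}),\end{aligned}$$ where $$\beta^{(1)}_j(\pmb{\tau}_{\{j,\ldots,d\}})=\lim_{n\to\infty}P\left(N^{**}_{r_n,\{j,\ldots,d\}}=0\,\middle|\,N^{*}_{r_n,\{j,\ldots,d\}}>0\right)$$ and $$\beta^{(2)}_{\{j\}\cup J}(\pmb{\tau}_{\{j\}\cup J})=\lim_{n\to\infty}k_nP\Big(\bigcap_{i\in\{j\}\cup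 J}\{N_{r_n,\{i\}}>0\}\,\Big|\,N^{*}_{r_n,\{j,\ldots,d\}}=0\Big),$$ provided that the limiting constants exist. (b) $$\theta(\pmb{\tau})\le\frac{1}{\Gamma(\pmb{\tau})}\left(\sum_{j=1}^d\theta_j\tau_j-\sum_{j=1}^{d-1}\theta^{**}_{\{j,\ldots,d\}}\tau^{**}_{\{j,\ldots,d\}}\Big(\bigwedge_{i=j}^d\tau_i\Big)\right).$$
   Context: Setting. $\{\mathbf{X}_n=(X_{n1},\ldots,X_{nd})\}_{n\ge1}$ is a stationary sequence of random vectors, $D=\{1,\ldots,d\}$, whose common distribution function $F$ has continuous marginals $F_j$ and satisfies $F^n(nx_1,\ldots,nx_d)\to\widehat H(x_1,\ldots,x_d)$, where $\widehat H$ is a multivariate extreme value distribution function with unit Fréchet marginals $\widehat H_j(x)=\exp(-x^{-1})$, $x>0$. $\wedge,\vee$ denote minimum and maximum. Levels. For $\pmb{\tau}=(\tau_1,\ldots,\tau_d)\in\mathbb{R}^d_+$ (all $\tau_j>0$), normalized levels $u_{nj}=u_{nj}^{(\tau_j)}$ are such that $nP(X_{1j}>u_{nj}^{(\tau_j)})\to\tau_j$ for each $j$; for instance $u_{nj}^{(\tau_j)}=n/\tau_j$. $\Gamma(\pmb{\tau})=\lim_{n\to\infty}nP\big(\bigcup_{j=1}^d\{X_{1j}>u_{nj}\}\big)$. $\pmb{\tau}_J=(\tau_j)_{j\in J}$. Counting processes. For $\emptyset\neq J\subset D$ and $m\le n$ (levels $u_{nj}$ fixed at index $n$), $N_{m,J}=\sum_{i=1}^m\mathbf{1}_{\{\bigcup_{j\in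 J}\{X_{ij}>u_{nj}\}\}}$, $N^*_{m,J}=\sum_{i=1}^m\mathbf{1}_{\{\bigcap_{j\in J}\{X_{ij}>u_{nj}\}\}}$, $N^{**}_{m,J}=\sum_{i=1}^m\mathbf{1}_{\{\bigwedge_{j\in J}X_{ij}>\bigvee_{j\in J}u_{nj}\}}$. When $J=D$ the index $J$ is omitted. Limiting mean numbers. $\Gamma^*_J(\pmb{\tau}_J)=\lim_n nP(\bigcap_{j\in J}\{X_{1j}>u_{nj}\})$ and $\tau^{**}_J(\bigwedge_{j\in J}\tau_j)=\lim_n nP(\bigcap_{j\in J}\{X_{1j}>\bigvee_{j\in J}u_{nj}\})=\lim_n nP(\bigcap_{j\in J}\{X_{1j}>n/\bigwedge_{j\in J}\tau_j\})$. Strong-mixing condition. With $\alpha_n(l)=\sup|P(B\cap C)-P(B)P(C)|$, the supremum being over $1\le p\le n-l$, $B\in\sigma(\mathbf{X}_1,\ldots,\mathbf{X}_p)$ and $C\in\sigma(\mathbf{X}_{p+l},\ldots,\mathbf{X}_n)$, there is $l_n=o(n)$ with $\alpha_n(l_n)\to0$. $\{k_n\}$ are integers with $k_n\to\infty$, $k_n\alpha_n(l_n)\to0$, $k_nl_n/n\to0$, and $r_n=[n/k_n]$. Extremal indexes. The (multivariate) extremal index is defined by $\theta(\pmb{\tau})\Gamma(\pmb{\tau})=\lim_n k_nP(N_{r_n}>0)$; the marginal extremal index $\theta_j$ (a constant) by $\theta_j\tau_j=\lim_n k_nP(N_{r_n,\{j\}}>0)$; and $\theta^*_J(\pmb{\tau}_J)\Gamma^*_J(\pmb{\tau}_J)=\lim_n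 k_nP(N^*_{r_n,J}>0)$, $\theta^{**}_J\tau^{**}_J(\bigwedge_{j\in J}\tau_j)=\lim_n k_nP(N^{**}_{r_n,J}>0)$, where $\theta^{**}_J$ does not depend on $\pmb{\tau}$. These extremal indexes are assumed to exist. *)

theory Defs
  imports "HOL-Probability.Probability"
begin

text \<open>
  A sequence of random vectors indexed by \<open>i \<ge> 1\<close> with components \<open>j \<in> D\<close> is a family
  \<open>X i j :: 'a \<Rightarrow> real\<close>; the values of \<open>X\<close> at \<open>i = 0\<close> or \<open>j \<notin> D\<close> are never used.
\<close>

definition stationary_vectors ::
  "'a measure \<Rightarrow> nat set \<Rightarrow> (nat \<Rightarrow> nat \<Rightarrow> 'a \<Rightarrow> real) \<Rightarrow> bool" where
  "stationary_vectors M D X \<longleftrightarrow>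
     (\<forall>m h. distr M (Pi\<^sub>M ({1..m} \<times> D) (\<lambda>_. borel)) (\<lambda>\<omega>. \<lambda>(i, j)\<in>{1..m} \<times> D. X (i + h) j \<omega>)
          = distr M (Pi\<^sub>M ({1..m} \<times> D) (\<lambda>_. borel)) (\<lambda>\<omega>. \<lambda>(i, j)\<in>{1..m} \<times> D. X i j \<omega>))"

definition vector_law ::
  "'a measure \<Rightarrow> nat set \<Rightarrow> (nat \<Rightarrow> 'a \<Rightarrow> real) \<Rightarrow> (nat \<Rightarrow> real) measure" where
  "vector_law M D Y = distr M (Pi\<^sub>M D (\<lambda>_. borel)) (\<lambda>\<omega>. \<lambda>j\<in>D. Y j \<omega>)"

definition joint_df :: "nat set \<Rightarrow> (nat \<Rightarrow> real) measure \<Rightarrow> (nat \<Rightarrow> real) \<Rightarrow> real" where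
  "joint_df D L x = \<P>(y in L. \<forall>j\<in>D. y j \<le> x j)"

definition marginal_df :: "(nat \<Rightarrow> real) measure \<Rightarrow> nat \<Rightarrow> real \<Rightarrow> real" where
  "marginal_df L j = cdf (distr L borel (\<lambda>y. y j))"

text \<open>
  Multivariate extreme value laws are the max-stable laws with nondegenerate marginals.
\<close>

definition mev_law :: "nat set \<Rightarrow> (nat \<Rightarrow> real) measure \<Rightarrow> bool" where
  "mev_law D H \<longleftrightarrow>
     prob_space H \<and> sets H = sets (Pi\<^sub>M D (\<lambda>_. borel)) \<and>
     (\<forall>j\<in>D. \<exists>x. 0 < marginal_df H j x \<and> marginal_df H j x < 1) \<and>
     (\<forall>m\<ge>1. \<exists>a b. (\<forall>j\<in>D. a j > 0) \<and>
        (\<forall>x. joint_df D H (\<lambda>j. a j * x j + b j) ^ m = joint_df D H x))"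

definition sigma_block ::
  "'a measure \<Rightarrow> nat set \<Rightarrow> (nat \<Rightarrow> nat \<Rightarrow> 'a \<Rightarrow> real) \<Rightarrow> nat set \<Rightarrow> 'a set set" where
  "sigma_block M D X I =
     sigma_sets (space M) {X i j -` A \<inter> space M | i j A. i \<in> I \<and> j \<in> D \<and> A \<in> sets borel}"

text \<open>
  For \<open>l \<ge> n\<close> the supremum is over the empty set and its value is meaningless; this concerns
  only finitely many \<open>n\<close> when \<open>l = l\<^sub>n = o(n)\<close>.
\<close>

definition mixing_coeff ::
  "'a measure \<Rightarrow> nat set \<Rightarrow> (nat \<Rightarrow> nat \<Rightarrow> 'a \<Rightarrow> real) \<Rightarrow> nat \<Rightarrow> nat \<Rightarrow> real" where
  "mixing_coeff M D X n l =
     (SUP (p, B, C) \<in> {(p, B, C). 1 \<le> p \<and> p + l \<le> n \<and>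
          B \<in> sigma_block M D X {1..p} \<and> C \<in> sigma_block M D X {p + l..n}}.
        \<bar>measure M (B \<inter> C) - measure M B * measure M C\<bar>)"

text \<open>\<open>u n j t\<close> is the level \<open>u\<^sub>n\<^sub>j\<close> with superscript \<open>t\<close>.\<close>

definition level_vector ::
  "(nat \<Rightarrow> nat \<Rightarrow> real \<Rightarrow> real) \<Rightarrow> (nat \<Rightarrow> real) \<Rightarrow> nat \<Rightarrow> nat \<Rightarrow> real" where
  "level_vector u \<tau> n j = u n j (\<tau> j)"

text \<open>
  The counting processes \<open>N\<close>, \<open>N\<^sup>*\<close> and \<open>N\<^sup>*\<^sup>*\<close> at level vector \<open>v\<close>, for the first \<open>m\<close> vectors.
\<close>

definition count_any ::
  "(nat \<Rightarrow> nat \<Rightarrow> 'a \<Rightarrow> real) \<Rightarrow> (nat \<Rightarrow> real) \<Rightarrow> nat \<Rightarrow> nat set \<Rightarrow> 'a \<Rightarrow> nat" where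
  "count_any X v m J \<omega> = (\<Sum>i=1..m. of_bool (\<exists>j\<in>J. X i j \<omega> > v j))"

definition count_all ::
  "(nat \<Rightarrow> nat \<Rightarrow> 'a \<Rightarrow> real) \<Rightarrow> (nat \<Rightarrow> real) \<Rightarrow> nat \<Rightarrow> nat set \<Rightarrow> 'a \<Rightarrow> nat" where
  "count_all X v m J \<omega> = (\<Sum>i=1..m. of_bool (\<forall>j\<in>J. X i j \<omega> > v j))"

definition count_minmax ::
  "(nat \<Rightarrow> nat \<Rightarrow> 'a \<Rightarrow> real) \<Rightarrow> (nat \<Rightarrow> real) \<Rightarrow> nat \<Rightarrow> nat set \<Rightarrow> 'a \<Rightarrow> nat" where
  "count_minmax X v m J \<omega> = (\<Sum>i=1..m. of_bool ((MIN j\<in>J. X i j \<omega>) > (MAX j\<in>J. v j)))"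

end

theory Submission
  imports Defs
begin

text \<open>
  Write \<open>A\<^sub>j\<close> for the event that component \<open>j\<close> exceeds its level within the block and \<open>S\<^sub>j\<close> for
  \<open>{N\<^sup>*\<^bsub>{j..d}\<^esub> > 0}\<close>. Peeling off the components one at a time gives
  \<open>P(\<Union>A\<^sub>j) = \<Sum>P(A\<^sub>j) - \<Sum>P(A\<^sub>j \<inter> \<Union>\<^bsub>i>j\<^esub>A\<^sub>i)\<close>. Since \<open>S\<^sub>j\<close> lies in every \<open>A\<^sub>i\<close> with \<open>i \<ge> j\<close>, the
  subtracted event is \<open>S\<^sub>j\<close> together with \<open>(A\<^sub>j \<inter> \<Union>\<^bsub>i>j\<^esub>A\<^sub>i) - S\<^sub>j\<close>. The first part is split according
  to whether \<open>N\<^sup>*\<^sup>*\<close> vanishes, the second is expanded by inclusion--exclusion. After multiplication by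
  \<open>k\<^sub>n\<close>, conditioning on the complement of \<open>S\<^sub>j\<close> is harmless because \<open>P(S\<^sub>j) = O(1/k\<^sub>n)\<close>. Dropping
  all but the \<open>N\<^sup>*\<^sup>*\<close> part of the subtracted event gives the inequality.
\<close>

text \<open>For fixed \<open>E\<close> the set function
  \<open>\<lambda>S. measure M (E \<inter> S)\<close> is still additive on disjoint measurable sets,
  which is all that abstract inclusion-exclusion asks for. The later choice
  \<open>E = A j - S j\<close> gives an expansion away from \<open>S j\<close>.\<close>

lemma (in finite_measure) measure_Int_UN_incl_excl:
  assumes "finite I" "E \<in> sets M" "\<And>i. i \<in> I \<Longrightarrow> A i \<in> sets M"
  shows "measure M (E \<inter> (\<Union>i\<in>I. A i))
    = (\<Sum>J | J \<noteq> {} \<and> J \<subseteq> I. (-1) ^ (card J + 1) * measure M (E \<inter> (\<Inter>j\<in>J. A j)))"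
proof -
  interpret Incl_Excl "\<lambda>S. S \<in> sets M" "\<lambda>S. measure M (E \<inter> S)"
  proof
    fix S T assume ST: "S \<in> sets M" "T \<in> sets M" "disjnt S T"
    have "measure M ((E \<inter> S) \<union> (E \<inter> T)) = measure M (E \<inter> S) + measure M (E \<inter> T)"
      by (rule finite_measure_Union) (use ST assms in \<open>auto simp: disjnt_def\<close>)
    then show "measure M (E \<inter> (S \<union> T)) = measure M (E \<inter> S) + measure M (E \<inter> T)"
      by (simp add: Int_Un_distrib)
  qed auto
  show ?thesis
    using restricted_indexed[of I A] assms by (simp add: conj_commute)
qed

text \<open>Downward induction from \<open>m = d\<close>: each step joins \<open>A m\<close> to the
  union of the later sets and subtracts their overlap. Nothing comes after \<open>A d\<close>, so
  the overlap sum stops before \<open>d\<close>.\<close>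

lemma (in finite_measure) measure_UN_atLeastAtMost_peel:
  fixes A :: "nat \<Rightarrow> 'a set"
  assumes "m \<le> d" "\<And>j. j \<in> {m..d} \<Longrightarrow> A j \<in> sets M"
  shows "measure M (\<Union>j\<in>{m..d}. A j)
    = (\<Sum>j=m..d. measure M (A j)) - (\<Sum>j\<in>{m..<d}. measure M (A j \<inter> (\<Union>i\<in>{j+1..d}. A i)))"
  using assms
proof (induction m rule: inc_induct)
  case base
  then show ?case by simp
next
  case (step m)
  let ?B = "\<Union>i\<in>{m+1..d}. A i"
  have "?B \<in> sets M" "A m \<in> sets M"
    using step by auto
  then have "measure M (A m \<union> ?B) = measure M (A m) + measure M ?B - measure M (A m \<inter> ?B)"
    by (simp add: measure_Un3 fmeasurable_eq_sets)
  moreover have "measure M ?B = (\<Sum>j=m+1..d. measure M (A j))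
      - (\<Sum>j\<in>{m+1..<d}. measure M (A j \<inter> (\<Union>i\<in>{j+1..d}. A i)))"
    using step by simp
  moreover have "{m..d} = insert m {m+1..d}" "{m..<d} = insert m {m+1..<d}"
    using step.hyps by auto
  ultimately show ?case by simp
qed

text \<open>This is the form of (a) for a single block, exact and free of limits. The three
  subtracted sums become the \<theta>ss, \<beta>1 and \<beta>2 terms once everything is scaled by
  \<open>k n\<close>.\<close>

lemma (in finite_measure) measure_UN_peel_split:
  fixes A S T :: "nat \<Rightarrow> 'a set"
  assumes d: "1 \<le> d"
    and meas: "\<And>j. j \<in> {1..d} \<Longrightarrow> A j \<in> sets M"
      "\<And>j. j \<in> {1..<d} \<Longrightarrow> S j \<in> sets M" "\<And>j. j \<in> {1..<d} \<Longrightarrow> T j \<in> sets M"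
    and TS: "\<And>j. j \<in> {1..<d} \<Longrightarrow> T j \<subseteq> S j"
    and SA: "\<And>i j. j \<in> {1..<d} \<Longrightarrow> i \<in> {j..d} \<Longrightarrow> S j \<subseteq> A i"
  shows "measure M (\<Union>j\<in>{1..d}. A j)
    = (\<Sum>j=1..d. measure M (A j)) - (\<Sum>j\<in>{1..<d}. measure M (T j))
      - (\<Sum>j\<in>{1..<d}. measure M (S j - T j))
      - (\<Sum>j\<in>{1..<d}. \<Sum>J | J \<noteq> {} \<and> J \<subseteq> {j+1..d}.
           (-1) ^ (card J + 1) * measure M ((\<Inter>i\<in>{j} \<union> J. A i) - S j))"
proof -
  have "measure M (A j \<inter> (\<Union>i\<in>{j+1..d}. A i)) = measure M (T j) + measure M (S j - T j)
      + (\<Sum>J | J \<noteq> {} \<and> J \<subseteq> {j+1..d}.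
           (-1) ^ (card J + 1) * measure M ((\<Inter>i\<in>{j} \<union> J. A i) - S j))"
    if j: "j \<in> {1..<d}" for j
  proof -
    let ?B = "\<Union>i\<in>{j+1..d}. A i"
    have m: "A j \<in> sets M" "S j \<in> sets M" "T j \<in> sets M" "\<And>i. i \<in> {j+1..d} \<Longrightarrow> A i \<in> sets M"
      using j meas by auto
    \<comment> \<open>Since \<open>j < d\<close>, the index \<open>d\<close> is among the later
      ones, so \<open>S j\<close> lies in \<open>?B\<close> through \<open>A d\<close>, and
      \<open>S j\<close> can be split off the overlap whole.\<close>
    have sub: "S j \<subseteq> A j" "S j \<subseteq> A d" "d \<in> {j+1..d}"
      using j SA by auto
    have "A j \<inter> ?B = S j \<union> ((A j - S j) \<inter> ?B)"
      using sub by blast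
    also have "measure M \<dots> = measure M (S j) + measure M ((A j - S j) \<inter> ?B)"
      by (rule finite_measure_Union) (use m in auto)
    also have "measure M ((A j - S j) \<inter> ?B) = (\<Sum>J | J \<noteq> {} \<and> J \<subseteq> {j+1..d}.
        (-1) ^ (card J + 1) * measure M ((A j - S j) \<inter> (\<Inter>i\<in>J. A i)))"
      by (rule measure_Int_UN_incl_excl) (use m in auto)
    also have "\<dots> = (\<Sum>J | J \<noteq> {} \<and> J \<subseteq> {j+1..d}.
        (-1) ^ (card J + 1) * measure M ((\<Inter>i\<in>{j} \<union> J. A i) - S j))"
      by (intro sum.cong refl arg_cong2[where f = "(*)"] arg_cong[where f = "measure M"]) auto
    also have "measure M (S j) = measure M (T j) + measure M (S j - T j)"
      using finite_measure_Diff[of "S j" "T j"] m TS[OF j] by simp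
    finally show ?thesis .
  qed
  from sum.cong[OF refl this, of "{1..<d}" "\<lambda>j. j"] show ?thesis
    using measure_UN_atLeastAtMost_peel[of 1 d A, OF d meas(1)] by (simp add: sum.distrib)
qed

text \<open>The product rule needs no positivity: if the conditioning event is null, the quotient is
  0 by the convention \<open>x / 0 = 0\<close>, and the joint event is null too.\<close>

lemma (in prob_space) cond_prob_mult:
  assumes "{\<omega> \<in> space M. Q \<omega>} \<in> events"
  shows "\<P>(\<omega> in M. P \<omega> \<bar> Q \<omega>) * \<P>(\<omega> in M. Q \<omega>) = \<P>(\<omega> in M. P \<omega> \<and> Q \<omega>)"
proof (cases "\<P>(\<omega> in M. Q \<omega>) = 0")
  case True
  have "\<P>(\<omega> in M. P \<omega> \<and> Q \<omega>) \<le> \<P>(\<omega> in M. Q \<omega>)"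
    using assms by (intro finite_measure_mono) auto
  then have "\<P>(\<omega> in M. P \<omega> \<and> Q \<omega>) = 0"
    using True by (simp add: measure_le_0_iff)
  then show ?thesis
    by (simp add: cond_prob_def)
qed (simp add: cond_prob_def)

lemma count_any_pos:
  "count_any X v m J \<omega> > 0 \<longleftrightarrow> (\<exists>i\<in>{1..m}. \<exists>j\<in>J. X i j \<omega> > v j)"
  by (auto simp: count_any_def sum_eq_0_iff simp flip: neq0_conv)

lemma count_all_pos:
  "count_all X v m J \<omega> > 0 \<longleftrightarrow> (\<exists>i\<in>{1..m}. \<forall>j\<in>J. X i j \<omega> > v j)"
  by (auto simp: count_all_def sum_eq_0_iff simp flip: neq0_conv)

text \<open>The minimum of the components exceeds the maximum of the levels exactly when every
  component exceeds every level. \<open>MIN\<close> and \<open>MAX\<close> have this meaning only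
  over a finite nonempty set.\<close>

lemma count_minmax_pos:
  assumes "finite J" "J \<noteq> {}"
  shows "count_minmax X v m J \<omega> > 0 \<longleftrightarrow> (\<exists>i\<in>{1..m}. \<forall>j\<in>J. \<forall>h\<in>J. X i j \<omega> > v h)"
  using assms by (auto simp: count_minmax_def sum_eq_0_iff Min_gr_iff Max_less_iff simp flip: neq0_conv)

theorem proposition2p3:
  fixes M :: "'a measure" and d :: nat
    and X :: "nat \<Rightarrow> nat \<Rightarrow> 'a \<Rightarrow> real"
    and H :: "(nat \<Rightarrow> real) measure"
    and u :: "nat \<Rightarrow> nat \<Rightarrow> real \<Rightarrow> real"
    and \<tau> :: "nat \<Rightarrow> real"
    and l k r :: "nat \<Rightarrow> nat"
    and \<theta> \<Gamma> :: "(nat \<Rightarrow> real) \<Rightarrow> real"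
    and \<theta>m :: "nat \<Rightarrow> real"
    and \<theta>s \<Gamma>s :: "nat set \<Rightarrow> (nat \<Rightarrow> real) \<Rightarrow> real"
    and \<theta>ss :: "nat set \<Rightarrow> real"
    and \<tau>ss :: "nat set \<Rightarrow> real \<Rightarrow> real"
  assumes M: "prob_space M"
    and d: "d \<ge> 1"
    and X: "\<And>i j. i \<ge> 1 \<Longrightarrow> j \<in> {1..d} \<Longrightarrow> X i j \<in> borel_measurable M"
    and stationary: "stationary_vectors M {1..d} X"
    and continuous_marginals:
      "\<And>j. j \<in> {1..d} \<Longrightarrow> continuous_on UNIV (marginal_df (vector_law M {1..d} (X 1)) j)"
    and H: "mev_law {1..d} H"
    and frechet: "\<And>j x. j \<in> {1..d} \<Longrightarrow> x > 0 \<Longrightarrow> marginal_df H j x = exp (- (1 / x))"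
    and attraction:
      "\<And>x. (\<lambda>n. joint_df {1..d} (vector_law M {1..d} (X 1)) (\<lambda>j. real n * x j) ^ n)
             \<longlonglongrightarrow> joint_df {1..d} H x"
    and l_small: "(\<lambda>n. real (l n) / real n) \<longlonglongrightarrow> 0"
    and mixing: "(\<lambda>n. mixing_coeff M {1..d} X n (l n)) \<longlonglongrightarrow> 0"
    and k_infinity: "filterlim k at_top sequentially"
    and k_mixing: "(\<lambda>n. real (k n) * mixing_coeff M {1..d} X n (l n)) \<longlonglongrightarrow> 0"
    and k_l: "(\<lambda>n. real (k n) * real (l n) / real n) \<longlonglongrightarrow> 0"
    and r: "\<And>n. r n = n div k n"
    and levels: "\<And>j t. j \<in> {1..d} \<Longrightarrow> t > 0 \<Longrightarrow>
      (\<lambda>n. real n * \<P>(\<omega> in M. X 1 j \<omega> > u n j t)) \<longlonglongrightarrow> t"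
    and \<tau>: "\<And>j. j \<in> {1..d} \<Longrightarrow> \<tau> j > 0"
    and \<Gamma>: "(\<lambda>n. real n * \<P>(\<omega> in M. \<exists>j\<in>{1..d}. X 1 j \<omega> > level_vector u \<tau> n j)) \<longlonglongrightarrow> \<Gamma> \<tau>"
    and \<Gamma>s: "\<And>j. j \<in> {1..<d} \<Longrightarrow>
      (\<lambda>n. real n * \<P>(\<omega> in M. \<forall>i\<in>{j..d}. X 1 i \<omega> > level_vector u \<tau> n i))
        \<longlonglongrightarrow> \<Gamma>s {j..d} (restrict \<tau> {j..d})"
    and \<tau>ss: "\<And>j \<sigma>. j \<in> {1..<d} \<Longrightarrow> (\<And>i. i \<in> {j..d} \<Longrightarrow> \<sigma> i > 0) \<Longrightarrow>
      (\<lambda>n. real n * \<P>(\<omega> in M. \<forall>i\<in>{j..d}. X 1 i \<omega> > (MAX h\<in>{j..d}. level_vector u \<sigma> n h)))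
        \<longlonglongrightarrow> \<tau>ss {j..d} (MIN i\<in>{j..d}. \<sigma> i)"
    and \<theta>: "(\<lambda>n. real (k n) * \<P>(\<omega> in M. count_any X (level_vector u \<tau> n) (r n) {1..d} \<omega> > 0))
        \<longlonglongrightarrow> \<theta> \<tau> * \<Gamma> \<tau>"
    and \<theta>m: "\<And>j \<sigma>. j \<in> {1..d} \<Longrightarrow> \<sigma> j > 0 \<Longrightarrow>
      (\<lambda>n. real (k n) * \<P>(\<omega> in M. count_any X (level_vector u \<sigma> n) (r n) {j} \<omega> > 0))
        \<longlonglongrightarrow> \<theta>m j * \<sigma> j"
    and \<theta>s: "\<And>j. j \<in> {1..<d} \<Longrightarrow>
      (\<lambda>n. real (k n) * \<P>(\<omega> in M. count_all X (level_vector u \<tau> n) (r n) {j..d} \<omega> > 0))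
        \<longlonglongrightarrow> \<theta>s {j..d} (restrict \<tau> {j..d}) * \<Gamma>s {j..d} (restrict \<tau> {j..d})"
    and \<theta>ss: "\<And>j \<sigma>. j \<in> {1..<d} \<Longrightarrow> (\<And>i. i \<in> {j..d} \<Longrightarrow> \<sigma> i > 0) \<Longrightarrow>
      (\<lambda>n. real (k n) * \<P>(\<omega> in M. count_minmax X (level_vector u \<sigma> n) (r n) {j..d} \<omega> > 0))
        \<longlonglongrightarrow> \<theta>ss {j..d} * \<tau>ss {j..d} (MIN i\<in>{j..d}. \<sigma> i)"
  shows
    "(\<forall>(\<beta>1 :: nat \<Rightarrow> (nat \<Rightarrow> real) \<Rightarrow> real) (\<beta>2 :: nat set \<Rightarrow> (nat \<Rightarrow> real) \<Rightarrow> real).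
        (\<forall>j\<in>{1..<d}.
           (\<lambda>n. \<P>(\<omega> in M. count_minmax X (level_vector u \<tau> n) (r n) {j..d} \<omega> = 0
                   \<bar> count_all X (level_vector u \<tau> n) (r n) {j..d} \<omega> > 0))
             \<longlonglongrightarrow> \<beta>1 j (restrict \<tau> {j..d})) \<longrightarrow>
        (\<forall>j\<in>{1..<d}. \<forall>J. J \<noteq> {} \<and> J \<subseteq> {j+1..d} \<longrightarrow>
           (\<lambda>n. real (k n) *
                \<P>(\<omega> in M. (\<forall>i\<in>{j} \<union> J. count_any X (level_vector u \<tau> n) (r n) {i} \<omega> > 0)
                   \<bar> count_all X (level_vector u \<tau> n) (r n) {j..d} \<omega> = 0))
             \<longlonglongrightarrow> \<beta>2 ({j} \<union> J) (restrict \<tau> ({j} \<union> J))) \<longrightarrow>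
        (\<lambda>n. real (k n) * \<P>(\<omega> in M. count_any X (level_vector u \<tau> n) (r n) {1..d} \<omega> > 0))
          \<longlonglongrightarrow> \<theta> \<tau> * \<Gamma> \<tau> \<and>
        \<theta> \<tau> * \<Gamma> \<tau> =
          (\<Sum>j=1..d. \<theta>m j * \<tau> j)
          - (\<Sum>j\<in>{1..<d}. \<theta>ss {j..d} * \<tau>ss {j..d} (MIN i\<in>{j..d}. \<tau> i))
          - (\<Sum>j\<in>{1..<d}. \<theta>s {j..d} (restrict \<tau> {j..d}) * \<Gamma>s {j..d} (restrict \<tau> {j..d})
                           * \<beta>1 j (restrict \<tau> {j..d}))
          - (\<Sum>j\<in>{1..<d}. \<Sum>J | J \<noteq> {} \<and> J \<subseteq> {j+1..d}.
               (-1) ^ (card J + 1) * \<beta>2 ({j} \<union> J) (restrict \<tau> ({j} \<union> J))))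
     \<and> \<theta> \<tau> \<le> 1 / \<Gamma> \<tau> *
          ((\<Sum>j=1..d. \<theta>m j * \<tau> j)
           - (\<Sum>j\<in>{1..<d}. \<theta>ss {j..d} * \<tau>ss {j..d} (MIN i\<in>{j..d}. \<tau> i)))"
proof -
  interpret prob_space M by (rule M)

  \<comment> \<open>Block events: measurability and inclusions\<close>
  define A where "A n j = {\<omega> \<in> space M. count_any X (level_vector u \<tau> n) (r n) {j} \<omega> > 0}" for n j
  define S where "S n j = {\<omega> \<in> space M. count_all X (level_vector u \<tau> n) (r n) {j..d} \<omega> > 0}" for n j
  define T where "T n j = {\<omega> \<in> space M. count_minmax X (level_vector u \<tau> n) (r n) {j..d} \<omega> > 0}" for n j
  \<comment> \<open>The premise \<open>i \<in> {1..m}\<close> has the shape left by the quantifier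
    over a block, and it excludes the unconstrained \<open>X 0\<close>.\<close>
  have level_sets: "{\<omega> \<in> space M. X i j \<omega> > c} \<in> events" if "i \<in> {1..m}" "j \<in> {1..d}" for i j m c
    using X[of i j] that by simp
  have meas_A: "A n j \<in> events" if "j \<in> {1..d}" for n j
    unfolding A_def count_any_pos using that
    by (intro sets.sets_Collect_finite_Ex level_sets) auto
  have meas_S: "S n j \<in> events" if "j \<in> {1..<d}" for n j
    unfolding S_def count_all_pos using that
    by (intro sets.sets_Collect_finite_Ex sets.sets_Collect_finite_All level_sets) auto
  have T_eq: "T n j = {\<omega> \<in> space M. \<exists>i\<in>{1..r n}. \<forall>j'\<in>{j..d}. \<forall>h\<in>{j..d}. X i j' \<omega> > level_vector u \<tau> n h}"
    if "j \<in> {1..<d}" for n j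
    using that by (simp add: T_def count_minmax_pos)
  have meas_T: "T n j \<in> events" if "j \<in> {1..<d}" for n j
    unfolding T_eq[OF that] using that
    by (intro sets.sets_Collect_finite_Ex sets.sets_Collect_finite_All level_sets) auto
  \<comment> \<open>Taking \<open>h = j'\<close> in the double quantifier leaves each component
    exceeding its own level.\<close>
  have TS: "T n j \<subseteq> S n j" if "j \<in> {1..<d}" for n j
    unfolding T_eq[OF that] S_def count_all_pos by blast
  have SA: "S n j \<subseteq> A n i" if "i \<in> {j..d}" for n i j
    using that by (auto simp: S_def A_def count_all_pos count_any_pos)
  have UN_A: "{\<omega> \<in> space M. count_any X (level_vector u \<tau> n) (r n) {1..d} \<omega> > 0} = (\<Union>j\<in>{1..d}. A n j)" for n
    by (auto simp: A_def count_any_pos)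
  note split = measure_UN_peel_split[OF d meas_A meas_S meas_T TS SA]

  \<comment> \<open>Limits of the scaled block probabilities\<close>
  have lim_U: "(\<lambda>n. real (k n) * prob (\<Union>j\<in>{1..d}. A n j)) \<longlonglongrightarrow> \<theta> \<tau> * \<Gamma> \<tau>"
    using \<theta> unfolding UN_A .
  have lim_A: "(\<lambda>n. real (k n) * prob (A n j)) \<longlonglongrightarrow> \<theta>m j * \<tau> j" if "j \<in> {1..d}" for j
    using \<theta>m[of j \<tau>] that \<tau> by (simp add: A_def)
  have lim_T: "(\<lambda>n. real (k n) * prob (T n j)) \<longlonglongrightarrow> \<theta>ss {j..d} * \<tau>ss {j..d} (MIN i\<in>{j..d}. \<tau> i)"
    if "j \<in> {1..<d}" for j
    using \<theta>ss[of j \<tau>] that \<tau> by (simp add: T_def)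
  have lim_S: "(\<lambda>n. real (k n) * prob (S n j))
      \<longlonglongrightarrow> \<theta>s {j..d} (restrict \<tau> {j..d}) * \<Gamma>s {j..d} (restrict \<tau> {j..d})" if "j \<in> {1..<d}" for j
    using \<theta>s[OF that] by (simp add: S_def)
  have k_top: "filterlim (\<lambda>n. real (k n)) at_top sequentially"
    using filterlim_compose[OF filterlim_real_sequentially k_infinity] .
  have prob_S_0: "(\<lambda>n. prob (S n j)) \<longlonglongrightarrow> 0" if "j \<in> {1..<d}" for j
  proof -
    have "(\<lambda>n. real (k n) * prob (S n j) / real (k n)) \<longlonglongrightarrow> 0"
      using tendsto_divide_0[OF lim_S[OF that] filterlim_at_top_imp_at_infinity[OF k_top]] .
    \<comment> \<open>Cancelling \<open>k n\<close> is valid only where \<open>k n > 0\<close>,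
      which holds from some index on.\<close>
    moreover have "\<forall>\<^sub>F n in sequentially. real (k n) * prob (S n j) / real (k n) = prob (S n j)"
      using filterlim_at_top_dense[THEN iffD1, OF k_top, rule_format, of 0]
      by eventually_elim simp
    ultimately show ?thesis
      by (rule Lim_transform_eventually)
  qed

  \<comment> \<open>The exact formula, given the limits \<beta>1 and \<beta>2\<close>
  have identity: "\<theta> \<tau> * \<Gamma> \<tau> =
          (\<Sum>j=1..d. \<theta>m j * \<tau> j)
          - (\<Sum>j\<in>{1..<d}. \<theta>ss {j..d} * \<tau>ss {j..d} (MIN i\<in>{j..d}. \<tau> i))
          - (\<Sum>j\<in>{1..<d}. \<theta>s {j..d} (restrict \<tau> {j..d}) * \<Gamma>s {j..d} (restrict \<tau> {j..d})
                           * \<beta>1 j (restrict \<tau> {j..d}))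
          - (\<Sum>j\<in>{1..<d}. \<Sum>J | J \<noteq> {} \<and> J \<subseteq> {j+1..d}.
               (-1) ^ (card J + 1) * \<beta>2 ({j} \<union> J) (restrict \<tau> ({j} \<union> J)))"
    if \<beta>1: "\<forall>j\<in>{1..<d}.
           (\<lambda>n. \<P>(\<omega> in M. count_minmax X (level_vector u \<tau> n) (r n) {j..d} \<omega> = 0
                   \<bar> count_all X (level_vector u \<tau> n) (r n) {j..d} \<omega> > 0))
             \<longlonglongrightarrow> \<beta>1 j (restrict \<tau> {j..d})"
      and \<beta>2: "\<forall>j\<in>{1..<d}. \<forall>J. J \<noteq> {} \<and> J \<subseteq> {j+1..d} \<longrightarrow>
           (\<lambda>n. real (k n) *
                \<P>(\<omega> in M. (\<forall>i\<in>{j} \<union> J. count_any X (level_vector u \<tau> n) (r n) {i} \<omega> > 0)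
                   \<bar> count_all X (level_vector u \<tau> n) (r n) {j..d} \<omega> = 0))
             \<longlonglongrightarrow> \<beta>2 ({j} \<union> J) (restrict \<tau> ({j} \<union> J))"
    for \<beta>1 :: "nat \<Rightarrow> (nat \<Rightarrow> real) \<Rightarrow> real" and \<beta>2 :: "nat set \<Rightarrow> (nat \<Rightarrow> real) \<Rightarrow> real"
  proof -
    have lim_ST: "(\<lambda>n. real (k n) * prob (S n j - T n j))
        \<longlonglongrightarrow> \<theta>s {j..d} (restrict \<tau> {j..d}) * \<Gamma>s {j..d} (restrict \<tau> {j..d}) * \<beta>1 j (restrict \<tau> {j..d})"
      if j: "j \<in> {1..<d}" for j
    proof -
      have ST: "S n j - T n j = {\<omega> \<in> space M. count_minmax X (level_vector u \<tau> n) (r n) {j..d} \<omega> = 0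
                 \<and> count_all X (level_vector u \<tau> n) (r n) {j..d} \<omega> > 0}" for n
        by (auto simp: S_def T_def)
      \<comment> \<open>This also holds when \<open>S n j\<close> is null, so the limit of
        \<open>k n\<close> times its probability may be 0.\<close>
      have cond: "prob (S n j - T n j) =
          \<P>(\<omega> in M. count_minmax X (level_vector u \<tau> n) (r n) {j..d} \<omega> = 0
                   \<bar> count_all X (level_vector u \<tau> n) (r n) {j..d} \<omega> > 0) * prob (S n j)" for n
        unfolding ST unfolding S_def
        by (rule cond_prob_mult[OF meas_S[OF j, of n, unfolded S_def], symmetric])
      have "real (k n) * prob (S n j - T n j) = real (k n) * prob (S n j) *
          \<P>(\<omega> in M. count_minmax X (level_vector u \<tau> n) (r n) {j..d} \<omega> = 0
                   \<bar> count_all X (level_vector u \<tau> n) (r n) {j..d} \<omega> > 0)" for n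
        unfolding cond mult.assoc by (intro arg_cong2[where f = "(*)"] refl mult.commute)
      then show ?thesis
        by (simp only:) (rule tendsto_mult[OF lim_S[OF j] \<beta>1[rule_format, OF j]])
    qed
    have lim_AS: "(\<lambda>n. real (k n) * prob ((\<Inter>i\<in>{j} \<union> J. A n i) - S n j))
        \<longlonglongrightarrow> \<beta>2 ({j} \<union> J) (restrict \<tau> ({j} \<union> J))"
      if j: "j \<in> {1..<d}" and J: "J \<noteq> {}" "J \<subseteq> {j+1..d}" for j J
    proof -
      have AS: "(\<Inter>i\<in>{j} \<union> J. A n i) - S n j =
          {\<omega> \<in> space M. (\<forall>i\<in>{j} \<union> J. count_any X (level_vector u \<tau> n) (r n) {i} \<omega> > 0)
                   \<and> count_all X (level_vector u \<tau> n) (r n) {j..d} \<omega> = 0}" for n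
        by (auto simp: S_def A_def)
      have compl: "space M - S n j = {\<omega> \<in> space M. count_all X (level_vector u \<tau> n) (r n) {j..d} \<omega> = 0}" for n
        by (auto simp: S_def)
      have meas_compl: "space M - S n j \<in> events" for n
        using meas_S[OF j] by blast
      have "prob ((\<Inter>i\<in>{j} \<union> J. A n i) - S n j) =
          \<P>(\<omega> in M. (\<forall>i\<in>{j} \<union> J. count_any X (level_vector u \<tau> n) (r n) {i} \<omega> > 0)
                   \<bar> count_all X (level_vector u \<tau> n) (r n) {j..d} \<omega> = 0) * prob (space M - S n j)" for n
        unfolding AS compl
        by (rule cond_prob_mult[OF meas_compl[of n, unfolded compl], symmetric])
      then have "real (k n) * prob ((\<Inter>i\<in>{j} \<union> J. A n i) - S n j) = real (k n) *
          \<P>(\<omega> in M. (\<forall>i\<in>{j} \<union> J. count_any X (level_vector u \<tau> n) (r n) {i} \<omega> > 0)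
                   \<bar> count_all X (level_vector u \<tau> n) (r n) {j..d} \<omega> = 0) * (1 - prob (S n j))" for n
        by (simp only: prob_compl[OF meas_S[OF j]] mult.assoc)
      \<comment> \<open>The conditioning event is the complement of \<open>S n j\<close>; its
        probability tends to 1, so the factor disappears in the limit.\<close>
      moreover have "(\<lambda>n. 1 - prob (S n j)) \<longlonglongrightarrow> 1"
        using tendsto_diff[OF tendsto_const prob_S_0[OF j], of 1] by simp
      note tendsto_mult[OF \<beta>2[rule_format, OF j conjI[OF J]] this, unfolded mult_1_right]
      ultimately show ?thesis
        by (simp only:)
    qed
    \<comment> \<open>The factor \<open>k n\<close> is moved inside the finite sums so that limits
      can be taken term by term; uniqueness of the limit against \<open>lim_U\<close> then yields
      the identity.\<close>
    have "(\<lambda>n. real (k n) * prob (\<Union>j\<in>{1..d}. A n j)) = (\<lambda>n.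
        (\<Sum>j=1..d. real (k n) * prob (A n j)) - (\<Sum>j\<in>{1..<d}. real (k n) * prob (T n j))
        - (\<Sum>j\<in>{1..<d}. real (k n) * prob (S n j - T n j))
        - (\<Sum>j\<in>{1..<d}. \<Sum>J | J \<noteq> {} \<and> J \<subseteq> {j+1..d}.
             (-1) ^ (card J + 1) * (real (k n) * prob ((\<Inter>i\<in>{j} \<union> J. A n i) - S n j))))"
      by (subst split) (simp_all add: right_diff_distrib sum_distrib_left mult.left_commute)
    moreover have "\<dots> \<longlonglongrightarrow> (\<Sum>j=1..d. \<theta>m j * \<tau> j)
          - (\<Sum>j\<in>{1..<d}. \<theta>ss {j..d} * \<tau>ss {j..d} (MIN i\<in>{j..d}. \<tau> i))
          - (\<Sum>j\<in>{1..<d}. \<theta>s {j..d} (restrict \<tau> {j..d}) * \<Gamma>s {j..d} (restrict \<tau> {j..d})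
                           * \<beta>1 j (restrict \<tau> {j..d}))
          - (\<Sum>j\<in>{1..<d}. \<Sum>J | J \<noteq> {} \<and> J \<subseteq> {j+1..d}.
               (-1) ^ (card J + 1) * \<beta>2 ({j} \<union> J) (restrict \<tau> ({j} \<union> J)))"
      by (intro tendsto_diff tendsto_sum tendsto_mult tendsto_const lim_A lim_T lim_ST lim_AS) auto
    ultimately show ?thesis
      by (intro LIMSEQ_unique[OF lim_U]) (simp only:)
  qed

  \<comment> \<open>The upper bound\<close>
  have bound: "\<theta> \<tau> * \<Gamma> \<tau> \<le> (\<Sum>j=1..d. \<theta>m j * \<tau> j)
           - (\<Sum>j\<in>{1..<d}. \<theta>ss {j..d} * \<tau>ss {j..d} (MIN i\<in>{j..d}. \<tau> i))"
  proof (rule LIMSEQ_le[OF lim_U])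
    show "(\<lambda>n. (\<Sum>j=1..d. real (k n) * prob (A n j)) - (\<Sum>j\<in>{1..<d}. real (k n) * prob (T n j)))
        \<longlonglongrightarrow> (\<Sum>j=1..d. \<theta>m j * \<tau> j)
           - (\<Sum>j\<in>{1..<d}. \<theta>ss {j..d} * \<tau>ss {j..d} (MIN i\<in>{j..d}. \<tau> i))"
      by (intro tendsto_diff tendsto_sum lim_A lim_T)
    have "real (k n) * prob (\<Union>j\<in>{1..d}. A n j)
        \<le> (\<Sum>j=1..d. real (k n) * prob (A n j)) - (\<Sum>j\<in>{1..<d}. real (k n) * prob (T n j))" for n
    proof -
      have "prob (T n j) \<le> prob (A n j \<inter> (\<Union>i\<in>{j+1..d}. A n i))" if j: "j \<in> {1..<d}" for j
      proof (rule finite_measure_mono)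
        show "T n j \<subseteq> A n j \<inter> (\<Union>i\<in>{j+1..d}. A n i)"
        proof -
          have "S n j \<subseteq> A n j" "S n j \<subseteq> A n d" "d \<in> {j+1..d}"
            using j SA by auto
          with TS[OF j, of n] show ?thesis
            by blast
        qed
        show "A n j \<inter> (\<Union>i\<in>{j+1..d}. A n i) \<in> events"
          using j by (intro sets.Int sets.finite_UN meas_A) auto
      qed
      from sum_mono[OF this, of "{1..<d}" "\<lambda>j. j"]
      have "prob (\<Union>j\<in>{1..d}. A n j) \<le> (\<Sum>j=1..d. prob (A n j)) - (\<Sum>j\<in>{1..<d}. prob (T n j))"
        using measure_UN_atLeastAtMost_peel[of 1 d "A n", OF d meas_A] by simp
      from mult_left_mono[OF this, of "real (k n)"] show ?thesis
        by (simp add: right_diff_distrib sum_distrib_left)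
    qed
    then show "\<exists>N. \<forall>n\<ge>N. real (k n) * prob (\<Union>j\<in>{1..d}. A n j)
        \<le> (\<Sum>j=1..d. real (k n) * prob (A n j)) - (\<Sum>j\<in>{1..<d}. real (k n) * prob (T n j))"
      by blast
  qed

  \<comment> \<open>Dividing the bound by \<open>\<Gamma> \<tau>\<close> requires it to be positive.
    The union contains the exceedance by component 1 alone, whose scaled probability tends to
    \<open>\<tau> 1 > 0\<close>.\<close>
  have "\<tau> 1 \<le> \<Gamma> \<tau>"
  proof (rule LIMSEQ_le[OF _ \<Gamma>])
    show "(\<lambda>n. real n * \<P>(\<omega> in M. X 1 1 \<omega> > level_vector u \<tau> n 1)) \<longlonglongrightarrow> \<tau> 1"
      using levels[of 1 "\<tau> 1"] \<tau>[of 1] d by (simp add: level_vector_def)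
    have "\<P>(\<omega> in M. X 1 1 \<omega> > level_vector u \<tau> n 1)
        \<le> \<P>(\<omega> in M. \<exists>j\<in>{1..d}. X 1 j \<omega> > level_vector u \<tau> n j)" for n
      using d by (intro finite_measure_mono sets.sets_Collect_finite_Ex level_sets[of 1 1]) auto
    then show "\<exists>N. \<forall>n\<ge>N. real n * \<P>(\<omega> in M. X 1 1 \<omega> > level_vector u \<tau> n 1)
        \<le> real n * \<P>(\<omega> in M. \<exists>j\<in>{1..d}. X 1 j \<omega> > level_vector u \<tau> n j)"
      by (simp add: mult_left_mono)
  qed
  then have "\<Gamma> \<tau> > 0"
    using \<tau>[of 1] d by simp
  with bound have "\<theta> \<tau> \<le> 1 / \<Gamma> \<tau> * ((\<Sum>j=1..d. \<theta>m j * \<tau> j)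
           - (\<Sum>j\<in>{1..<d}. \<theta>ss {j..d} * \<tau>ss {j..d} (MIN i\<in>{j..d}. \<tau> i)))"
    by (simp add: field_simps)
  then show ?thesis
    by (intro conjI allI impI \<theta> identity)
qed

end
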